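(* Let $G=(V,E)$ be a finite graph (multiple edges and loops allowed) with symmetric digraph $\Delta(G)=(V,\mathcal{A}(G))$, let $\tau_1,\tau_2:\mathcal{A}(G)\to\mathbb{C}$ be arbitrary maps, and let $$\theta(a,a')=\tau_1(a)\tau_2(a')\,\delta_{\mathfrak{h}(a)\,\mathfrak{t}(a')}-\delta_{a^{-1}a'}\qquad(a,a'\in\mathcal{A}(G)),$$ where $\delta_{a^{-1}a'}=1$ if $a'=a^{-1}$ and $0$ otherwise. Let $A^\theta_G=(a_{uv})_{u,v\in V}$ and $D^\theta_G=(d_{uv})_{u,v\in V}$ with $$a_{uv}=\sum_{a\in\mathcal{A}_{uv}}\tau_1(a)\tau_2(a),\qquad d_{uv}=\delta_{uv}\sum_{a\in\mathcal{A}(G),\ \mathfrak{t}(a)=u}\tau_1(a^{-1})\tau_2(a).$$ Then, as formal power series in $t$, $$Z_{\Delta(G)}(t;\theta)^{-1}=(1-t^2)^{|E|-|V|}\det\!\left(I-tA^\theta_G+t^2(D^\theta_G-I)\right).$$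
   Context: The symmetric digraph $\Delta(G)$ has, for each edge $e=\{u,v\}\in E$, two arcs $a_e=(u,v)$ and $a_e'=(v,u)$ (for a loop $e=\{v,v\}$ these are two distinct loops at $v$); these two arcs are declared inverse to each other, $a_e^{-1}=a_e'$, $(a_e')^{-1}=a_e$, and an arc has no other inverse. $\mathfrak{t}(a),\mathfrak{h}(a)$ are tail and head of $a$, $\mathcal{A}_{uv}$ is the set of arcs with tail $u$ and head $v$. A closed path of length $k$ is a sequence of arcs $C=(c_1,\dots,c_k)$ with $\mathfrak{h}(c_i)=\mathfrak{t}(c_{i+1})$ for $1\le i<k$ and $\mathfrak{h}(c_k)=\mathfrak{t}(c_1)$; $X_k$ is the set of closed paths of length $k$. For $C\in X_k$, $\mathrm{circ}_\theta(C)=\theta(c_1,c_2)\theta(c_2,c_3)\cdots\theta(c_{k-1},c_k)\theta(c_k,c_1)$, and $N_k=\sum_{C\in X_k}\mathrm{circ}_\theta(C)$. The zeta function is $Z_{\Delta(G)}(t;\theta)=\exp\!\left(\sum_{k\ge1}\frac{N_k}{k}t^k\right)$. *)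

theory Defs
  imports
    Complex_Main
    "HOL-Library.Uprod"
    "HOL-Computational_Algebra.Formal_Power_Series"
    "Graph_Theory.Digraph"
    "Jordan_Normal_Form.Determinant"
begin

text \<open>
  Undirected graphs with multiple edges and loops: edges are abstract objects, each with an
  unordered pair of end vertices; a loop at \<open>v\<close> has the pair \<open>Upair v v\<close>.
\<close>

record ('v, 'e) multigraph =
  gverts :: "'v set"
  gedges :: "'e set"
  gends :: "'e \<Rightarrow> 'v uprod"

definition finite_multigraph :: "('v, 'e) multigraph \<Rightarrow> bool" where
  "finite_multigraph G \<longleftrightarrow> finite (gverts G) \<and> finite (gedges G) \<and>
     (\<forall>e\<in>gedges G. set_uprod (gends G e) \<subseteq> gverts G)"

text \<open>
  Naming the two arcs of an edge \<open>{u, v}\<close> as \<open>a\<^sub>e = (u, v)\<close> and \<open>a\<^sub>e' = (v, u)\<close> requires choosing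
  an order of its ends. Such a choice is an orientation \<open>\<omega>\<close>; \<open>(e, True)\<close> encodes \<open>a\<^sub>e\<close> and
  \<open>(e, False)\<close> encodes \<open>a\<^sub>e'\<close>, so a loop yields two distinct arcs that are mutually inverse.
\<close>

definition orientation :: "('v, 'e) multigraph \<Rightarrow> ('e \<Rightarrow> 'v \<times> 'v) \<Rightarrow> bool" where
  "orientation G \<omega> \<longleftrightarrow> (\<forall>e\<in>gedges G. gends G e = Upair (fst (\<omega> e)) (snd (\<omega> e)))"

lemma orientation_exists: "\<exists>\<omega>. orientation G \<omega>"
proof -
  have "\<exists>p. gends G e = Upair (fst p) (snd p)" for e
    by (cases "gends G e") auto
  then show ?thesis
    unfolding orientation_def by metis
qed

definition symmetric_digraph ::
    "('v, 'e) multigraph \<Rightarrow> ('e \<Rightarrow> 'v \<times> 'v) \<Rightarrow> ('v, 'e \<times> bool) pre_digraph" where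
  "symmetric_digraph G \<omega> =
     \<lparr> verts = gverts G,
       arcs = gedges G \<times> UNIV,
       tail = (\<lambda>(e, b). if b then fst (\<omega> e) else snd (\<omega> e)),
       head = (\<lambda>(e, b). if b then snd (\<omega> e) else fst (\<omega> e)) \<rparr>"

definition arc_inv :: "'e \<times> bool \<Rightarrow> 'e \<times> bool" where
  "arc_inv a = (fst a, \<not> snd a)"

definition arcs_from_to :: "('v, 'a) pre_digraph \<Rightarrow> 'v \<Rightarrow> 'v \<Rightarrow> 'a set" where
  "arcs_from_to D u v = {a \<in> arcs D. tail D a = u \<and> head D a = v}"

text \<open>Paths are 0-indexed lists of arcs; \<open>closed_paths D k\<close> is only meaningful for \<open>k \<ge> 1\<close>.\<close>

definition closed_paths :: "('v, 'a) pre_digraph \<Rightarrow> nat \<Rightarrow> 'a list set" where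
  "closed_paths D k =
     {C. length C = k \<and> set C \<subseteq> arcs D \<and>
         (\<forall>i. Suc i < k \<longrightarrow> head D (C ! i) = tail D (C ! Suc i)) \<and>
         head D (last C) = tail D (hd C)}"

definition circ :: "('a \<Rightarrow> 'a \<Rightarrow> complex) \<Rightarrow> 'a list \<Rightarrow> complex" where
  "circ \<theta> C = (\<Prod>i<length C. \<theta> (C ! i) (C ! (Suc i mod length C)))"

definition circ_sum :: "('v, 'a) pre_digraph \<Rightarrow> ('a \<Rightarrow> 'a \<Rightarrow> complex) \<Rightarrow> nat \<Rightarrow> complex" where
  "circ_sum D \<theta> k = (\<Sum>C\<in>closed_paths D k. circ \<theta> C)"

definition zeta_fps :: "('v, 'a) pre_digraph \<Rightarrow> ('a \<Rightarrow> 'a \<Rightarrow> complex) \<Rightarrow> complex fps" where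
  "zeta_fps D \<theta> =
     fps_exp 1 oo Abs_fps (\<lambda>k. if k = 0 then 0 else circ_sum D \<theta> k / of_nat k)"

definition theta_weight ::
    "('v, 'e \<times> bool) pre_digraph \<Rightarrow> ('e \<times> bool \<Rightarrow> complex) \<Rightarrow> ('e \<times> bool \<Rightarrow> complex) \<Rightarrow>
     'e \<times> bool \<Rightarrow> 'e \<times> bool \<Rightarrow> complex" where
  "theta_weight D \<tau>\<^sub>1 \<tau>\<^sub>2 a a' =
     \<tau>\<^sub>1 a * \<tau>\<^sub>2 a' * (if head D a = tail D a' then 1 else 0) - (if a' = arc_inv a then 1 else 0)"

definition adj_entry ::
    "('v, 'a) pre_digraph \<Rightarrow> ('a \<Rightarrow> complex) \<Rightarrow> ('a \<Rightarrow> complex) \<Rightarrow> 'v \<Rightarrow> 'v \<Rightarrow> complex" where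
  "adj_entry D \<tau>\<^sub>1 \<tau>\<^sub>2 u v = (\<Sum>a\<in>arcs_from_to D u v. \<tau>\<^sub>1 a * \<tau>\<^sub>2 a)"

definition deg_entry ::
    "('v, 'e \<times> bool) pre_digraph \<Rightarrow> ('e \<times> bool \<Rightarrow> complex) \<Rightarrow> ('e \<times> bool \<Rightarrow> complex) \<Rightarrow>
     'v \<Rightarrow> 'v \<Rightarrow> complex" where
  "deg_entry D \<tau>\<^sub>1 \<tau>\<^sub>2 u v =
     (if u = v then \<Sum>a\<in>out_arcs D u. \<tau>\<^sub>1 (arc_inv a) * \<tau>\<^sub>2 a else 0)"

text \<open>
  A family \<open>(m u v)\<close> indexed by the members of the list \<open>vs\<close> (an enumeration of the vertices),
  as a matrix whose constant entries are regarded as formal power series.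
\<close>

definition fps_matrix :: "'v list \<Rightarrow> ('v \<Rightarrow> 'v \<Rightarrow> complex) \<Rightarrow> complex fps mat" where
  "fps_matrix vs m =
     mat (length vs) (length vs) (\<lambda>(i, j). fps_const (m (vs ! i) (vs ! j)))"

end

theory Submission
  imports Defs "Jordan_Normal_Form.Schur_Decomposition"
begin

text \<open>
  Let \<open>M = (\<theta>(a, a'))\<close> be the arc-indexed weight matrix. As \<open>\<theta>(a, a')\<close> vanishes unless the head of
  \<open>a\<close> is the tail of \<open>a'\<close>, \<open>N\<^sub>k\<close> is the trace of \<open>M\<^sup>k\<close>, so triangularising \<open>M\<close> gives
  \<open>Z(t)\<close> as the inverse of \<open>det (1 - t M)\<close>. Now \<open>M = K L - J\<close>, where \<open>K\<close> (arcs by vertices) carries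
  \<open>\<tau>\<^sub>1\<close> on heads, \<open>L\<close> (vertices by arcs) carries \<open>\<tau>\<^sub>2\<close> on tails and \<open>J\<close> is the arc inversion.
  Since \<open>(1 + t J) (1 - t J) = 1 - t\<^sup>2\<close> and \<open>det (1 + t J) = (1 - t\<^sup>2)\<^bsup>|E|\<^esup>\<close>, Sylvester's identity
  turns \<open>det (1 + t J - t K L)\<close> into \<open>(1 - t\<^sup>2)\<^bsup>|E| - |V|\<^esup>\<close> times
  \<open>det (1 - t\<^sup>2 - t L K + t\<^sup>2 L J K)\<close>, and \<open>L K = A\<close>, \<open>L J K = D\<close>.
\<close>

section \<open>Traces of powers and the characteristic determinant\<close>

definition mat_trace :: "'a :: comm_monoid_add mat \<Rightarrow> 'a" where
  "mat_trace A = (\<Sum>i<dim_row A. A $$ (i, i))"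

lemma mat_trace_mult_commute:
  fixes A B :: "'a :: comm_semiring_0 mat"
  assumes "A \<in> carrier_mat n m" "B \<in> carrier_mat m n"
  shows "mat_trace (A * B) = mat_trace (B * A)"
proof -
  have "mat_trace (A * B) = (\<Sum>i<n. \<Sum>j<m. A $$ (i, j) * B $$ (j, i))"
    using assms by (auto simp: mat_trace_def scalar_prod_def atLeast0LessThan intro!: sum.cong)
  also have "\<dots> = (\<Sum>j<m. \<Sum>i<n. B $$ (j, i) * A $$ (i, j))"
    by (subst sum.swap) (simp add: mult.commute)
  also have "\<dots> = mat_trace (B * A)"
    using assms by (auto simp: mat_trace_def scalar_prod_def atLeast0LessThan intro!: sum.cong)
  finally show ?thesis .
qed

text \<open>Cyclicity of the trace brings \<open>Q\<close> next to \<open>P\<close>, where they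
  cancel.\<close>

lemma mat_trace_similar:
  fixes A :: "'a :: comm_ring_1 mat"
  assumes "similar_mat_wit A B P Q"
  shows "mat_trace A = mat_trace B"
proof -
  define n where "n = dim_row A"
  note wit = similar_mat_witD[OF n_def assms]
  have "mat_trace A = mat_trace (P * (B * Q))"
    using wit by (metis assoc_mult_mat)
  also have "\<dots> = mat_trace (B * Q * P)"
    using wit by (intro mat_trace_mult_commute[where n = n and m = n]) auto
  also have "B * Q * P = B"
    using wit by (metis assoc_mult_mat right_mult_one_mat)
  finally show ?thesis .
qed

text \<open>In the product sum the factor from \<open>A\<close> vanishes for \<open>k < i\<close>,
  and the factor from \<open>B\<close> vanishes for \<open>k > i\<close>, hence
  \<open>k > j\<close>. Only \<open>k = i\<close> survives.\<close>

lemma upper_triangular_mult_entry: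
  fixes A B :: "'a :: semiring_1 mat"
  assumes A: "A \<in> carrier_mat n n" "upper_triangular A"
    and B: "B \<in> carrier_mat n n" "upper_triangular B"
    and ij: "i < n" "j \<le> i"
  shows "(A * B) $$ (i, j) = (if i = j then A $$ (i, i) * B $$ (i, i) else 0)"
proof -
  have "(A * B) $$ (i, j) = (\<Sum>k<n. A $$ (i, k) * B $$ (k, j))"
    using assms by (auto simp: scalar_prod_def atLeast0LessThan intro!: sum.cong)
  also have "\<dots> = (\<Sum>k<n. if k = i then A $$ (i, i) * B $$ (i, j) else 0)"
  proof (intro sum.cong refl)
    fix k assume "k \<in> {..<n}"
    then show "A $$ (i, k) * B $$ (k, j) = (if k = i then A $$ (i, i) * B $$ (i, j) else 0)"
      using assms upper_triangularD[OF A(2), of k i] upper_triangularD[OF B(2), of j k]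
      by (cases k i rule: linorder_cases) auto
  qed
  also have "\<dots> = A $$ (i, i) * B $$ (i, j)"
    using ij by simp
  also have "\<dots> = (if i = j then A $$ (i, i) * B $$ (i, i) else 0)"
    using assms upper_triangularD[OF B(2), of j i] by auto
  finally show ?thesis .
qed

text \<open>Triangularity and the diagonal are proved together, because taking diagonals is
  multiplicative only once the previous power is known to be triangular.\<close>

lemma upper_triangular_pow:
  fixes A :: "'a :: semiring_1 mat"
  assumes A: "A \<in> carrier_mat n n" "upper_triangular A"
  shows "upper_triangular (A ^\<^sub>m k) \<and> (\<forall>i<n. (A ^\<^sub>m k) $$ (i, i) = A $$ (i, i) ^ k)"
proof (induction k)
  case 0
  then show ?case using A by auto
next
  case (Suc k)
  have "A ^\<^sub>m k \<in> carrier_mat n n" using A by simp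
  note entry = upper_triangular_mult_entry[OF this conjunct1[OF Suc] A]
  show ?case
  proof (intro conjI upper_triangularI allI impI)
    show "(A ^\<^sub>m Suc k) $$ (i, j) = 0" if "j < i" "i < dim_row (A ^\<^sub>m Suc k)" for i j
      using that A entry[of i j] by simp
    show "(A ^\<^sub>m Suc k) $$ (i, i) = A $$ (i, i) ^ Suc k" if "i < n" for i
      using that entry[of i i] Suc by (simp add: power_commutes)
  qed
qed

lemma mat_trace_pow_upper_triangular:
  fixes A :: "'a :: semiring_1 mat"
  assumes "A \<in> carrier_mat n n" "upper_triangular A"
  shows "mat_trace (A ^\<^sub>m k) = (\<Sum>x\<leftarrow>diag_mat A. x ^ k)"
proof -
  have "mat_trace (A ^\<^sub>m k) = (\<Sum>i<n. A $$ (i, i) ^ k)"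
    using assms upper_triangular_pow[OF assms, of k] by (auto simp: mat_trace_def intro!: sum.cong)
  also have "\<dots> = (\<Sum>x\<leftarrow>diag_mat A. x ^ k)"
    using assms by (simp add: diag_mat_def sum_list_sum_nth atLeast0LessThan)
  finally show ?thesis .
qed

section \<open>Power sums as the logarithm of a product of linear factors\<close>

text \<open>This is minus the logarithm of the product of the factors
  \<open>1 - fps_const e * fps_X\<close>. The zero constant term makes substitution into
  \<open>fps_exp 1\<close> legitimate.\<close>

definition fps_power_sums :: "'a :: field_char_0 list \<Rightarrow> 'a fps" where
  "fps_power_sums es = Abs_fps (\<lambda>k. if k = 0 then 0 else (\<Sum>e\<leftarrow>es. e ^ k) / of_nat k)"

text \<open>The logarithmic derivative of the product, cleared of denominators so that no power
  series is divided. Each further factor contributes minus a geometric series.\<close>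

lemma fps_deriv_linear_factors:
  fixes es :: "'a :: field_char_0 list"
  defines "W \<equiv> \<lambda>es. (\<Prod>e\<leftarrow>es. 1 - fps_const e * fps_X)"
  shows "fps_deriv (W es) = - (W es * fps_deriv (fps_power_sums es))"
proof (induction es)
  case Nil
  have "fps_power_sums [] = (0 :: 'a fps)"
    by (simp add: fps_power_sums_def fps_eq_iff)
  then show ?case by (simp add: W_def)
next
  case (Cons e es)
  have split: "fps_deriv (fps_power_sums (e # es)) = Abs_fps (\<lambda>k. e ^ Suc k) + fps_deriv (fps_power_sums es)"
    by (simp add: fps_power_sums_def fps_eq_iff add_divide_distrib algebra_simps del: of_nat_Suc power_Suc)
  \<comment> \<open>Differentiation has cancelled the denominators \<open>k\<close>; what remains is
    the geometric series of e/(1 - e X), multiplied out.\<close>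
  have geom: "(1 - fps_const e * fps_X) * Abs_fps (\<lambda>k. e ^ Suc k) = fps_const e"
    by (simp add: fps_eq_iff algebra_simps power_eq_if)
  have "fps_deriv (W (e # es)) = - (fps_const e * W es) + (1 - fps_const e * fps_X) * fps_deriv (W es)"
    by (simp add: W_def algebra_simps)
  also have "\<dots> = - ((1 - fps_const e * fps_X) * Abs_fps (\<lambda>k. e ^ Suc k) * W es)
      - (1 - fps_const e * fps_X) * (W es * fps_deriv (fps_power_sums es))"
    unfolding geom Cons.IH by simp
  also have "\<dots> = - (W (e # es) * fps_deriv (fps_power_sums (e # es)))"
    unfolding split by (simp add: W_def algebra_simps)
  finally show ?case .
qed

text \<open>With S the power-sum series, the exponential F satisfies F' = F S' and the product W
  satisfies W' = - W S'. So F W has derivative zero, and its constant term is 1.\<close>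

lemma inverse_fps_exp_power_sums:
  fixes es :: "'a :: field_char_0 list"
  shows "inverse (fps_exp 1 oo fps_power_sums es) = (\<Prod>e\<leftarrow>es. 1 - fps_const e * fps_X)"
proof -
  define W where "W = (\<Prod>e\<leftarrow>es. 1 - fps_const e * fps_X)"
  define F where "F = fps_exp 1 oo fps_power_sums es"
  have L0: "fps_nth (fps_power_sums es) 0 = 0" by (simp add: fps_power_sums_def)
  have W0: "fps_nth W 0 = 1" unfolding W_def by (induction es) auto
  have F0: "fps_nth F 0 = 1" by (simp add: F_def)
  have "fps_deriv F = F * fps_deriv (fps_power_sums es)"
    unfolding F_def by (subst fps_compose_deriv[OF L0]) simp
  then have "fps_deriv (F * W) = 0"
    using fps_deriv_linear_factors[of es] by (simp add: W_def algebra_simps)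
  then have "F * W = fps_const (fps_nth (F * W) 0)"
    by (simp only: fps_deriv_eq_0_iff)
  then have "F * W = 1" using W0 F0 by simp
  then show ?thesis unfolding F_def[symmetric] W_def[symmetric]
    by (rule fps_inverse_unique)
qed

lemma fps_const_comm_ring_hom: "comm_ring_hom (fps_const :: 'a :: comm_ring_1 \<Rightarrow> 'a fps)"
  by unfold_locales auto

lemma det_one_minus_upper_triangular:
  fixes B :: "'a :: comm_ring_1 mat"
  assumes "B \<in> carrier_mat n n" "upper_triangular B"
  shows "det (1\<^sub>m n - fps_X \<cdot>\<^sub>m map_mat fps_const B) = (\<Prod>e\<leftarrow>diag_mat B. 1 - fps_const e * fps_X)"
proof -
  have "det (1\<^sub>m n - fps_X \<cdot>\<^sub>m map_mat fps_const B) =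
      prod_list (diag_mat (1\<^sub>m n - fps_X \<cdot>\<^sub>m map_mat fps_const B))"
    using assms upper_triangularD[OF assms(2)]
    by (intro det_upper_triangular[of _ n] upper_triangularI) auto
  also have "diag_mat (1\<^sub>m n - fps_X \<cdot>\<^sub>m map_mat fps_const B) = map (\<lambda>e. 1 - fps_const e * fps_X) (diag_mat B)"
    using assms by (auto simp: diag_mat_def mult.commute)
  finally show ?thesis .
qed

text \<open>Schur triangularisation makes \<open>M\<close> similar to an upper triangular
  \<open>B\<close>. The traces of powers are the power sums of the diagonal of \<open>B\<close>,
  which settles the triangular case, and similarity carries the determinant back to
  \<open>M\<close>.\<close>

lemma inverse_exp_traces_eq_det:
  fixes M :: "complex mat"
  assumes M: "M \<in> carrier_mat n n"
  shows "inverse (fps_exp 1 oo Abs_fps (\<lambda>k. if k = 0 then 0 else mat_trace (M ^\<^sub>m k) / of_nat k)) =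
    det (1\<^sub>m n - fps_X \<cdot>\<^sub>m map_mat fps_const M)"
proof -
  interpret hom: comm_ring_hom "fps_const :: complex \<Rightarrow> complex fps"
    by (rule fps_const_comm_ring_hom)
  obtain es where "char_poly M = (\<Prod>e\<leftarrow>es. [:- e, 1:])"
    using char_poly_factorized[OF M] by auto
  moreover obtain B P Q where schur: "schur_decomposition M es = (B, P, Q)"
    by (cases "schur_decomposition M es") auto
  ultimately have sim: "similar_mat_wit M B P Q" and ut: "upper_triangular B"
    using schur_decomposition[OF M] by blast+
  note wit = similar_mat_witD2[OF M sim]
  have tr: "mat_trace (M ^\<^sub>m k) = (\<Sum>e\<leftarrow>diag_mat B. e ^ k)" for k
    using mat_trace_similar[OF similar_mat_wit_pow[OF sim]] mat_trace_pow_upper_triangular[OF _ ut] wit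
    by metis
  have "inverse (fps_exp 1 oo Abs_fps (\<lambda>k. if k = 0 then 0 else mat_trace (M ^\<^sub>m k) / of_nat k)) =
      det (1\<^sub>m n - fps_X \<cdot>\<^sub>m map_mat fps_const B)"
    unfolding tr using inverse_fps_exp_power_sums[of "diag_mat B"] det_one_minus_upper_triangular[OF wit(5) ut]
    by (simp add: fps_power_sums_def)
  also have "\<dots> = det (1\<^sub>m n - fps_X \<cdot>\<^sub>m map_mat fps_const M)"
  proof -
    \<comment> \<open>Since \<open>fps_const\<close> is a ring homomorphism, the similarity persists
      over power series, and the scalar \<open>fps_X\<close> passes through the conjugation.\<close>
    define P' Q' B' where "P' = map_mat fps_const P" and "Q' = map_mat fps_const Q"
      and "B' = map_mat fps_const B"
    have c: "P' \<in> carrier_mat n n" "Q' \<in> carrier_mat n n" "B' \<in> carrier_mat n n"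
      using wit by (auto simp: P'_def Q'_def B'_def)
    have PQ: "P' * Q' = 1\<^sub>m n"
      using wit hom.mat_hom_mult[of P n n Q n] hom.mat_hom_one[of n] by (simp add: P'_def Q'_def)
    have M': "map_mat fps_const M = P' * B' * Q'"
      using wit hom.mat_hom_mult[of P n n B n] hom.mat_hom_mult[of "P * B" n n Q n]
      by (simp add: P'_def Q'_def B'_def)
    have "1\<^sub>m n - fps_X \<cdot>\<^sub>m map_mat fps_const M = P' * (1\<^sub>m n - fps_X \<cdot>\<^sub>m B') * Q'"
    proof -
      have "P' * (1\<^sub>m n - fps_X \<cdot>\<^sub>m B') * Q' = (P' * 1\<^sub>m n - P' * (fps_X \<cdot>\<^sub>m B')) * Q'"
        using c by (subst mult_minus_distrib_mat[of _ n n _ n]) auto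
      also have "\<dots> = P' * 1\<^sub>m n * Q' - P' * (fps_X \<cdot>\<^sub>m B') * Q'"
        using c by (subst minus_mult_distrib_mat[of _ n n _ _ n]) auto
      also have "P' * (fps_X \<cdot>\<^sub>m B') * Q' = fps_X \<cdot>\<^sub>m (P' * B' * Q')"
        using c by (simp add: mult_smult_distrib[of _ n n _ n] mult_smult_assoc_mat[of _ n n _ n])
      finally show ?thesis using c PQ M' by simp
    qed
    then have "det (1\<^sub>m n - fps_X \<cdot>\<^sub>m map_mat fps_const M) = det P' * det (1\<^sub>m n - fps_X \<cdot>\<^sub>m B') * det Q'"
      using c det_mult[of P' n "1\<^sub>m n - fps_X \<cdot>\<^sub>m B'"]
        det_mult[of "P' * (1\<^sub>m n - fps_X \<cdot>\<^sub>m B')" n Q'] by (simp add: minus_carrier_mat)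
    moreover have "det P' * det Q' = 1"
      using c PQ by (metis det_mult det_one)
    ultimately show ?thesis
      by (simp add: B'_def mult.commute mult.left_commute)
  qed
  finally show ?thesis .
qed

section \<open>Closed paths as traces\<close>

text \<open>Rows and columns are labelled by list members such as arcs or vertices, so that a matrix
  product becomes a sum over a set when the inner list is distinct.\<close>

definition fun_mat :: "'i list \<Rightarrow> 'j list \<Rightarrow> ('i \<Rightarrow> 'j \<Rightarrow> 'a) \<Rightarrow> 'a mat" where
  "fun_mat is js f = mat (length is) (length js) (\<lambda>(i, j). f (is ! i) (js ! j))"

lemma fun_mat_carrier [simp]: "fun_mat is js f \<in> carrier_mat (length is) (length js)"
  and fun_mat_dim [simp]: "dim_row (fun_mat is js f) = length is" "dim_col (fun_mat is js f) = length js"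
  and fun_mat_index [simp]: "i < length is \<Longrightarrow> j < length js \<Longrightarrow> fun_mat is js f $$ (i, j) = f (is ! i) (js ! j)"
  by (auto simp: fun_mat_def)

lemma fun_mat_cong:
  assumes "\<And>i j. i \<in> set is \<Longrightarrow> j \<in> set js \<Longrightarrow> f i j = g i j"
  shows "fun_mat is js f = fun_mat is js g"
  using assms by (intro eq_matI) auto

lemma sum_nth_distinct: "distinct xs \<Longrightarrow> (\<Sum>i<length xs. f (xs ! i)) = sum f (set xs)"
  by (rule sum.reindex_bij_betw) (auto simp: bij_betw_def inj_on_nth set_conv_nth)

lemma fun_mat_mult:
  fixes f :: "'i \<Rightarrow> 'j \<Rightarrow> 'a :: semiring_0"
  assumes "distinct js"
  shows "fun_mat is js f * fun_mat js ks g = fun_mat is ks (\<lambda>i k. \<Sum>j\<in>set js. f i j * g j k)"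
  using assms
  by (intro eq_matI)
    (auto simp: scalar_prod_def atLeast0LessThan sum_nth_distinct[symmetric] intro!: sum.cong)

lemma fun_mat_one: "distinct is \<Longrightarrow> fun_mat is is (\<lambda>i j. if i = j then 1 else 0) = 1\<^sub>m (length is)"
  by (intro eq_matI) (auto simp: nth_eq_iff_index_eq)

lemma mat_trace_fun_mat: "distinct is \<Longrightarrow> mat_trace (fun_mat is is f) = (\<Sum>i\<in>set is. f i i)"
  by (simp add: mat_trace_def sum_nth_distinct[symmetric])

lemma pow_mat_Suc_left:
  fixes A :: "'a :: semiring_1 mat"
  assumes "A \<in> carrier_mat n n"
  shows "A ^\<^sub>m Suc k = A * A ^\<^sub>m k"
proof (induction k)
  case (Suc k)
  have "A ^\<^sub>m Suc (Suc k) = A * A ^\<^sub>m k * A" using Suc by simp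
  also have "\<dots> = A * (A ^\<^sub>m k * A)" using assms by (intro assoc_mult_mat) auto
  finally show ?case by simp
qed (use assms in auto)

section \<open>Path weights and entries of matrix powers\<close>

text \<open>The end points are kept apart from the interior list because they serve as row and
  column index of the matrix power to which the path contributes.\<close>

fun path_weight :: "('a \<Rightarrow> 'a \<Rightarrow> 'b :: comm_semiring_1) \<Rightarrow> 'a \<Rightarrow> 'a list \<Rightarrow> 'a \<Rightarrow> 'b" where
  "path_weight m a [] b = m a b"
| "path_weight m a (x # xs) b = m a x * path_weight m x xs b"

lemma path_weight_eq_prod:
  "path_weight m a xs b = (\<Prod>i<Suc (length xs). m ((a # xs) ! i) ((xs @ [b]) ! i))"
proof (induction xs arbitrary: a)
  case (Cons x xs)
  then show ?case
    by (subst prod.lessThan_Suc_shift) simp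
qed simp

text \<open>The cyclic successor index wraps to 0 only at the last position, exactly where the
  appended \<open>a\<close> stands.\<close>

lemma circ_Cons: "circ m (a # xs) = path_weight m a xs a"
proof -
  have "(a # xs) ! (Suc i mod Suc (length xs)) = (xs @ [a]) ! i" if "i < Suc (length xs)" for i
    using that by (cases "i = length xs") (simp_all add: nth_append)
  then show ?thesis
    unfolding circ_def path_weight_eq_prod by (intro prod.cong arg_cong2[where f = m]) simp_all
qed

lemma sum_lists_length_Suc:
  "(\<Sum>xs | set xs \<subseteq> S \<and> length xs = Suc k. f xs) = (\<Sum>x\<in>S. \<Sum>xs | set xs \<subseteq> S \<and> length xs = k. f (x # xs))"
proof -
  have "(\<Sum>xs | set xs \<subseteq> S \<and> length xs = Suc k. f xs) =
      (\<Sum>(x, xs)\<in>S \<times> {xs. set xs \<subseteq> S \<and> length xs = k}. f (x # xs))"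
    by (intro sum.reindex_bij_witness[where i = "\<lambda>(x, xs). x # xs" and j = "\<lambda>xs. (hd xs, tl xs)"])
      (auto simp: length_Suc_conv)
  then show ?thesis
    by (simp add: sum.cartesian_product)
qed

text \<open>Induction splits off the first step. A path with \<open>k\<close> interior points takes
  \<open>Suc k\<close> steps, hence the shift between exponent and list length.\<close>

lemma pow_fun_mat:
  fixes m :: "'a \<Rightarrow> 'a \<Rightarrow> 'b :: comm_semiring_1"
  assumes "distinct as"
  shows "fun_mat as as m ^\<^sub>m Suc k =
    fun_mat as as (\<lambda>a b. \<Sum>xs | set xs \<subseteq> set as \<and> length xs = k. path_weight m a xs b)"
proof (induction k)
  case 0
  have "{xs. set xs \<subseteq> set as \<and> length xs = 0} = {[]}" by auto
  then show ?case by (simp add: left_mult_one_mat[OF fun_mat_carrier])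
next
  case (Suc k)
  have "fun_mat as as m ^\<^sub>m Suc (Suc k) = fun_mat as as m * fun_mat as as m ^\<^sub>m Suc k"
    by (rule pow_mat_Suc_left[OF fun_mat_carrier])
  also have "\<dots> = fun_mat as as (\<lambda>a b. \<Sum>xs | set xs \<subseteq> set as \<and> length xs = Suc k. path_weight m a xs b)"
    unfolding Suc fun_mat_mult[OF assms]
    by (intro fun_mat_cong) (simp add: sum_lists_length_Suc sum_distrib_left)
  finally show ?case .
qed

text \<open>A list of arcs that is not a closed path has two cyclically consecutive arcs at which
  \<open>\<theta>\<close> vanishes, so its product is zero. The sum may therefore run over all lists
  of length \<open>k\<close>, and grouping by the first arc gives the diagonal entries of the
  power.\<close>

lemma circ_sum_eq_trace:
  assumes as: "distinct as" "set as = arcs D"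
    and \<theta>: "\<And>a b. \<lbrakk>a \<in> arcs D; b \<in> arcs D; head D a \<noteq> tail D b\<rbrakk> \<Longrightarrow> \<theta> a b = 0"
    and k: "k > 0"
  shows "circ_sum D \<theta> k = mat_trace (fun_mat as as \<theta> ^\<^sub>m k)"
proof -
  obtain l where l: "k = Suc l" using k by (cases k) auto
  define X where "X = {C. set C \<subseteq> arcs D \<and> length C = k}"
  have "finite X"
    unfolding X_def using finite_lists_length_eq[of "arcs D" k] as(2) by (metis List.finite_set)
  moreover have "closed_paths D k \<subseteq> X"
    by (auto simp: X_def closed_paths_def)
  moreover have "circ \<theta> C = 0" if C: "C \<in> X - closed_paths D k" for C
  proof -
    have len: "length C = k" "C \<noteq> []" and in_arcs: "\<And>i. i < k \<Longrightarrow> C ! i \<in> arcs D"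
      using C k by (auto simp: X_def)
    have "\<exists>i<k. head D (C ! i) \<noteq> tail D (C ! (Suc i mod k))"
    proof (rule ccontr)
      assume "\<not> ?thesis"
      then have *: "head D (C ! i) = tail D (C ! (Suc i mod k))" if "i < k" for i
        using that by auto
      have "head D (C ! i) = tail D (C ! Suc i)" if "Suc i < k" for i
        using *[of i] that by simp
      \<comment> \<open>The cyclic successor of index \<open>k - 1\<close> is 0, which yields the
        closing condition.\<close>
      moreover have "head D (last C) = tail D (hd C)"
        using *[of "k - 1"] len k by (simp add: last_conv_nth hd_conv_nth)
      ultimately have "C \<in> closed_paths D k"
        using C by (auto simp: closed_paths_def X_def)
      then show False using C by simp
    qed
    then obtain i where i: "i < k" "head D (C ! i) \<noteq> tail D (C ! (Suc i mod k))" by blast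
    then have "\<theta> (C ! i) (C ! (Suc i mod k)) = 0"
      using in_arcs k by (intro \<theta>) auto
    then show ?thesis
      using i(1) len(1) unfolding circ_def by (intro prod_zero) auto
  qed
  ultimately have "circ_sum D \<theta> k = (\<Sum>C\<in>X. circ \<theta> C)"
    unfolding circ_sum_def by (intro sum.mono_neutral_left) auto
  also have "\<dots> = (\<Sum>a\<in>arcs D. \<Sum>xs | set xs \<subseteq> arcs D \<and> length xs = l. path_weight \<theta> a xs a)"
    unfolding X_def l sum_lists_length_Suc circ_Cons ..
  also have "\<dots> = mat_trace (fun_mat as as \<theta> ^\<^sub>m k)"
    unfolding l pow_fun_mat[OF as(1)] mat_trace_fun_mat[OF as(1)] as(2) ..
  finally show ?thesis .
qed

lemma inverse_zeta_fps_eq_det: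
  assumes as: "distinct as" "set as = arcs D"
    and \<theta>: "\<And>a b. \<lbrakk>a \<in> arcs D; b \<in> arcs D; head D a \<noteq> tail D b\<rbrakk> \<Longrightarrow> \<theta> a b = 0"
  shows "inverse (zeta_fps D \<theta>) =
    det (1\<^sub>m (length as) - fps_X \<cdot>\<^sub>m fun_mat as as (\<lambda>a b. fps_const (\<theta> a b)))"
proof -
  \<comment> \<open>Both inner series have coefficient 0 at \<open>k = 0\<close>, so the trace
    formula for positive \<open>k\<close> identifies them.\<close>
  have "zeta_fps D \<theta> = fps_exp 1 oo Abs_fps (\<lambda>k. if k = 0 then 0 else mat_trace (fun_mat as as \<theta> ^\<^sub>m k) / of_nat k)"
    unfolding zeta_fps_def using circ_sum_eq_trace[OF assms]
    by (intro arg_cong[where f = "fps_compose _"]) (simp add: fps_eq_iff)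
  moreover have "map_mat fps_const (fun_mat as as \<theta>) = fun_mat as as (\<lambda>a b. fps_const (\<theta> a b))"
    by (intro eq_matI) auto
  ultimately show ?thesis
    using inverse_exp_traces_eq_det[OF fun_mat_carrier, of as \<theta>] by simp
qed

section \<open>Reduction from arcs to vertices\<close>

text \<open>Sylvester's identity: both sides are Schur complements of \<open>four_block_mat 1 U V 1\<close>.\<close>

lemma det_one_minus_mult_commute:
  fixes U V :: "'a :: idom mat"
  assumes U: "U \<in> carrier_mat n m" and V: "V \<in> carrier_mat m n"
  shows "det (1\<^sub>m n - U * V) = det (1\<^sub>m m - V * U)"
proof -
  let ?L = "four_block_mat (1\<^sub>m n) (0\<^sub>m n m) V (1\<^sub>m m)"
  let ?R = "four_block_mat (1\<^sub>m n) U (0\<^sub>m m n) (1\<^sub>m m - V * U)"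
  let ?R' = "four_block_mat (1\<^sub>m n - U * V) U (0\<^sub>m m n) (1\<^sub>m m)"
  have VU: "1\<^sub>m m - V * U \<in> carrier_mat m m" and UV: "1\<^sub>m n - U * V \<in> carrier_mat n n"
    using U V by auto
  have "?L * ?R = four_block_mat (1\<^sub>m n) U V (1\<^sub>m m)"
    using U V by (subst mult_four_block_mat[of _ n n _ m _ m _ _ n _ m]) (auto intro!: arg_cong2[where f = "four_block_mat _ _"])
  moreover have "?R' * ?L = four_block_mat (1\<^sub>m n) U V (1\<^sub>m m)"
    using U V by (subst mult_four_block_mat[of _ n n _ m _ m _ _ n _ m]) (auto intro!: arg_cong2[where f = "four_block_mat _ _"])
  ultimately have "det (?L * ?R) = det (?R' * ?L)" by simp
  moreover have "det ?L = 1"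
    using V by (subst det_four_block_mat_upper_right_zero[of _ n _ m]) auto
  moreover have "det ?R = det (1\<^sub>m m - V * U)"
    using U VU by (subst det_four_block_mat_lower_left_zero[of _ n _ m]) auto
  moreover have "det ?R' = det (1\<^sub>m n - U * V)"
    using U UV by (subst det_four_block_mat_lower_left_zero[of _ n _ m]) auto
  moreover have "?L \<in> carrier_mat (n + m) (n + m)" "?R \<in> carrier_mat (n + m) (n + m)"
      "?R' \<in> carrier_mat (n + m) (n + m)"
    using VU UV by auto
  ultimately show ?thesis
    by (simp add: det_mult[of _ "n + m"])
qed

text \<open>Since \<open>J\<close> squares to the identity, 1 + t J has inverse c (1 - t J).
  Factoring it out leaves 1 - U L, to which Sylvester's identity applies; \<open>c ^ m\<close>
  arises from pulling the scalar \<open>c\<close> out of an m by m determinant. Taking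
  \<open>c\<close> as a solution of an equation suits integral domains that are not fields, such as
  power series.\<close>

lemma det_one_plus_involution_minus_mult:
  fixes t c :: "'a :: idom"
  assumes J: "J \<in> carrier_mat n n" "J * J = 1\<^sub>m n"
    and K: "K \<in> carrier_mat n m" and L: "L \<in> carrier_mat m n"
    and c: "c * (1 - t ^ 2) = 1"
  shows "det (1\<^sub>m n + t \<cdot>\<^sub>m J - t \<cdot>\<^sub>m (K * L)) =
    det (1\<^sub>m n + t \<cdot>\<^sub>m J) * (c ^ m * det (1\<^sub>m m - t \<cdot>\<^sub>m (L * K) + t ^ 2 \<cdot>\<^sub>m (L * (J * K) - 1\<^sub>m m)))"
proof -
  define P where "P = 1\<^sub>m n + t \<cdot>\<^sub>m J"
  define P' where "P' = 1\<^sub>m n - t \<cdot>\<^sub>m J"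
  \<comment> \<open>Chosen so that \<open>P * U = t \<cdot>\<^sub>m K\<close>, because
    \<open>c \<cdot>\<^sub>m P'\<close> inverts \<open>P\<close>.\<close>
  define U where "U = (c * t) \<cdot>\<^sub>m (P' * K)"
  have carr: "P \<in> carrier_mat n n" "P' \<in> carrier_mat n n" "U \<in> carrier_mat n m"
      "P' * K \<in> carrier_mat n m" "U * L \<in> carrier_mat n n" "L * U \<in> carrier_mat m m"
    using J K L by (auto simp: P_def P'_def U_def)
  have "P * P' = P - t \<cdot>\<^sub>m (P * J)"
    unfolding P'_def using carr J
    by (subst mult_minus_distrib_mat[of _ n n _ n]) (auto simp: mult_smult_distrib[of _ n n _ n])
  also have "P * J = J + t \<cdot>\<^sub>m 1\<^sub>m n"
    unfolding P_def using J
    by (subst add_mult_distrib_mat[of _ n n _ _ n]) (auto simp: mult_smult_assoc_mat[of _ n n _ n])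
  also have "P - t \<cdot>\<^sub>m (J + t \<cdot>\<^sub>m 1\<^sub>m n) = (1 - t ^ 2) \<cdot>\<^sub>m 1\<^sub>m n"
    unfolding P_def using J by (intro eq_matI) (auto simp: algebra_simps power2_eq_square)
  finally have PP': "P * P' = (1 - t ^ 2) \<cdot>\<^sub>m 1\<^sub>m n" .
  have "P * U = (c * t) \<cdot>\<^sub>m (P * P' * K)"
    unfolding U_def using carr K
    by (simp add: mult_smult_distrib[of _ n n _ m] assoc_mult_mat[of _ n n _ n _ m])
  also have "\<dots> = (c * t * (1 - t ^ 2)) \<cdot>\<^sub>m K"
  proof -
    have "(1 - t ^ 2) \<cdot>\<^sub>m 1\<^sub>m n * K = (1 - t ^ 2) \<cdot>\<^sub>m K"
      using K by (subst mult_smult_assoc_mat[of _ n n _ m]) auto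
    then show ?thesis
      unfolding PP' by (intro eq_matI) auto
  qed
  also have "c * t * (1 - t ^ 2) = t"
    using c by (simp add: mult.commute[of c t] mult.assoc)
  finally have "P * (U * L) = t \<cdot>\<^sub>m (K * L)"
    using assoc_mult_mat[OF carr(1,3) L] mult_smult_assoc_mat[OF K L, of t] by simp
  then have "1\<^sub>m n + t \<cdot>\<^sub>m J - t \<cdot>\<^sub>m (K * L) = P * (1\<^sub>m n - U * L)"
    using carr by (subst mult_minus_distrib_mat[of _ n n _ n]) (auto simp: P_def[symmetric])
  then have "det (1\<^sub>m n + t \<cdot>\<^sub>m J - t \<cdot>\<^sub>m (K * L)) = det P * det (1\<^sub>m m - L * U)"
    using carr det_one_minus_mult_commute[OF carr(3) L] det_mult[of P n "1\<^sub>m n - U * L"]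
    by (simp add: minus_carrier_mat)
  also have "L * U = (c * t) \<cdot>\<^sub>m (L * K - t \<cdot>\<^sub>m (L * (J * K)))"
  proof -
    have "P' * K = K - t \<cdot>\<^sub>m (J * K)"
      unfolding P'_def using J K
      by (subst minus_mult_distrib_mat[of _ n n _ _ m]) (auto simp: mult_smult_assoc_mat[of _ n n _ m])
    then have "L * (P' * K) = L * K - L * (t \<cdot>\<^sub>m (J * K))"
      using J K L by (simp add: mult_minus_distrib_mat[of _ m n _ m])
    also have "L * (t \<cdot>\<^sub>m (J * K)) = t \<cdot>\<^sub>m (L * (J * K))"
      using J K L by (intro mult_smult_distrib) auto
    finally show ?thesis
      unfolding U_def using carr L by (simp add: mult_smult_distrib[of _ m n _ m])
  qed
  also have "1\<^sub>m m - \<dots> = c \<cdot>\<^sub>m (1\<^sub>m m - t \<cdot>\<^sub>m (L * K) + t ^ 2 \<cdot>\<^sub>m (L * (J * K) - 1\<^sub>m m))"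
  proof -
    \<comment> \<open>Here \<open>a\<close>, \<open>x\<close>, \<open>y\<close> stand for entries of
      the identity, of \<open>L * K\<close> and of \<open>L * (J * K)\<close>. The relation for
      \<open>c\<close> turns \<open>c * (1 - t ^ 2) * a\<close> into \<open>a\<close>.\<close>
    have "a - c * t * (x - t * y) = c * (a - t * x + t ^ 2 * (y - a))" for a x y
    proof -
      have "c * (a - t * x + t ^ 2 * (y - a)) = c * (1 - t ^ 2) * a - c * t * (x - t * y)"
        by (simp add: algebra_simps power2_eq_square)
      then show ?thesis using c by simp
    qed
    note entry = this
    show ?thesis
      using J K L by (intro eq_matI) (simp_all add: entry del: index_mult_mat(1))
  qed
  finally show ?thesis
    using K J L by (simp add: P_def)
qed

text \<open>A series with nonzero constant term is a unit, so powers of \<open>s\<close> cancel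
  against powers of \<open>inverse s\<close>; the two cases are the two signs of the
  exponent.\<close>

lemma fps_power_int_diff:
  fixes s :: "'a :: field fps"
  assumes "fps_nth s 0 \<noteq> 0"
  shows "s powi (int a - int b) = s ^ a * inverse s ^ b"
proof -
  have s: "s * inverse s = 1" using inverse_mult_eq_1[OF assms] by (simp add: mult.commute)
  have cancel: "s ^ (d + j) * inverse s ^ j = s ^ d" "s ^ j * inverse s ^ (d + j) = inverse s ^ d" for d j
  proof -
    have "s ^ j * inverse s ^ j = 1" using s by (simp flip: power_mult_distrib)
    then show "s ^ (d + j) * inverse s ^ j = s ^ d" "s ^ j * inverse s ^ (d + j) = inverse s ^ d"
      by (simp_all add: power_add mult.assoc mult.left_commute)
  qed
  show ?thesis
  proof (cases "b \<le> a")
    case True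
    then show ?thesis using cancel(1)[of "a - b" b] by (simp add: power_int_def nat_diff_distrib flip: of_nat_diff)
  next
    case False
    then show ?thesis using cancel(2)[of a "b - a"]
      by (simp add: power_int_def nat_diff_distrib flip: of_nat_diff)
  qed
qed

lemma sum_fps_const: "(\<Sum>x\<in>S. fps_const (f x)) = fps_const (sum f S)"
  by (simp add: fps_eq_iff fps_sum_nth)

text \<open>In this order arc inversion becomes an off-diagonal block matrix.\<close>

definition arc_list :: "'e list \<Rightarrow> ('e \<times> bool) list" where
  "arc_list es = map (\<lambda>e. (e, True)) es @ map (\<lambda>e. (e, False)) es"

lemma length_arc_list [simp]: "length (arc_list es) = length es + length es"
  by (simp add: arc_list_def)

lemma set_arc_list [simp]: "set (arc_list es) = set es \<times> UNIV"
  by (auto simp: arc_list_def)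

lemma distinct_arc_list: "distinct es \<Longrightarrow> distinct (arc_list es)"
  by (auto simp: arc_list_def distinct_map inj_on_def)

lemma arc_inv_simps [simp]: "arc_inv (arc_inv a) = a" "fst (arc_inv a) = fst a"
  "arc_inv (e, b) = (e, \<not> b)"
  by (simp_all add: arc_inv_def)

text \<open>The matrix consists of four scalar blocks, 1 on the diagonal and t off it. They commute,
  so its determinant is that of the single block 1 - t^2.\<close>

lemma det_arc_inv:
  fixes t :: "'a :: idom"
  assumes "distinct es"
  defines "as \<equiv> arc_list es"
  shows "det (1\<^sub>m (length as) + t \<cdot>\<^sub>m fun_mat as as (\<lambda>a b. if b = arc_inv a then 1 else 0)) = (1 - t ^ 2) ^ length es"
proof -
  define n where "n = length es"
  have "1\<^sub>m (length as) + t \<cdot>\<^sub>m fun_mat as as (\<lambda>a b. if b = arc_inv a then 1 else 0) =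
      four_block_mat (1\<^sub>m n) (t \<cdot>\<^sub>m 1\<^sub>m n) (t \<cdot>\<^sub>m 1\<^sub>m n) (1\<^sub>m n)"
    using assms(1)
    by (intro eq_matI) (auto simp: as_def n_def arc_list_def nth_append nth_eq_iff_index_eq)
  also have "det \<dots> = det ((1 - t ^ 2) \<cdot>\<^sub>m 1\<^sub>m n :: 'a mat)"
  proof -
    have "t \<cdot>\<^sub>m 1\<^sub>m n * (t \<cdot>\<^sub>m 1\<^sub>m n) = t ^ 2 \<cdot>\<^sub>m (1\<^sub>m n :: 'a mat)"
      by (subst mult_smult_assoc_mat[of _ n n _ n]) (auto simp: power2_eq_square intro!: eq_matI)
    then have "1\<^sub>m n * 1\<^sub>m n - t \<cdot>\<^sub>m 1\<^sub>m n * (t \<cdot>\<^sub>m 1\<^sub>m n) = (1 - t ^ 2) \<cdot>\<^sub>m (1\<^sub>m n :: 'a mat)"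
      by (intro eq_matI) auto
    then show ?thesis
      by (subst det_four_block_mat[of _ n]) simp_all
  qed
  finally show ?thesis by (simp add: n_def)
qed

section \<open>The weight matrix of a symmetric digraph and its factorisation\<close>

theorem theorem3p7:
  fixes G :: "('v, 'e) multigraph"
    and \<omega> :: "'e \<Rightarrow> 'v \<times> 'v"
    and vs :: "'v list"
    and \<tau>\<^sub>1 \<tau>\<^sub>2 :: "'e \<times> bool \<Rightarrow> complex"
  assumes "finite_multigraph G"
    and "orientation G \<omega>"
    and "distinct vs" and "set vs = gverts G"
  defines "\<Delta> \<equiv> symmetric_digraph G \<omega>"
  defines "\<theta> \<equiv> theta_weight \<Delta> \<tau>\<^sub>1 \<tau>\<^sub>2"
  defines "A \<equiv> fps_matrix vs (adj_entry \<Delta> \<tau>\<^sub>1 \<tau>\<^sub>2)"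
  defines "D \<equiv> fps_matrix vs (deg_entry \<Delta> \<tau>\<^sub>1 \<tau>\<^sub>2)"
  defines "I \<equiv> 1\<^sub>m (card (gverts G)) :: complex fps mat"
  shows "inverse (zeta_fps \<Delta> \<theta>) =
     (1 - fps_X ^ 2) powi (int (card (gedges G)) - int (card (gverts G))) *
     det (I - fps_X \<cdot>\<^sub>m A + fps_X ^ 2 \<cdot>\<^sub>m (D - I))"
proof -
  have "finite (gedges G)" using assms(1) by (simp add: finite_multigraph_def)
  then obtain es where es: "distinct es" "set es = gedges G"
    using finite_distinct_list by blast
  define as where "as = arc_list es"
  define n where "n = length as"
  define m where "m = length vs"
  have as: "distinct as" "set as = arcs \<Delta>"
    using es by (auto simp: as_def distinct_arc_list \<Delta>_def symmetric_digraph_def)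
  have card: "card (gedges G) = length es" "card (gverts G) = m"
    using es assms(3,4) distinct_card by (auto simp: m_def) fastforce+
  have head_inv [simp]: "head \<Delta> (arc_inv a) = tail \<Delta> a" and tail_inv: "tail \<Delta> (arc_inv a) = head \<Delta> a" for a
    by (cases a; simp add: \<Delta>_def symmetric_digraph_def)+
  have inv_arc: "arc_inv a \<in> arcs \<Delta> \<longleftrightarrow> a \<in> arcs \<Delta>" for a
    by (cases a) (simp add: \<Delta>_def symmetric_digraph_def)
  \<comment> \<open>Edges end in vertices of the graph, so the head of every arc occurs in the
    vertex sum that defines the entries of \<open>K * L\<close>.\<close>
  have head_vs: "head \<Delta> a \<in> set vs" if "a \<in> arcs \<Delta>" for a
    using that assms(1,2,4)
    by (cases a) (force simp: \<Delta>_def symmetric_digraph_def finite_multigraph_def orientation_def)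
  have fin: "finite (arcs \<Delta>)" using as(2) by (metis List.finite_set)
  define K where "K = fun_mat as vs (\<lambda>a v. fps_const (if head \<Delta> a = v then \<tau>\<^sub>1 a else 0))"
  define L where "L = fun_mat vs as (\<lambda>v a. fps_const (if tail \<Delta> a = v then \<tau>\<^sub>2 a else 0))"
  define J where "J = fun_mat as as (\<lambda>a b. if b = arc_inv a then 1 else 0 :: complex fps)"
  have carr: "K \<in> carrier_mat n m" "L \<in> carrier_mat m n" "J \<in> carrier_mat n n"
    by (simp_all add: K_def L_def J_def n_def m_def)
  \<comment> \<open>Left multiplication by \<open>J\<close> permutes rows by arc inversion. This
    gives both \<open>J * J = 1\<^sub>m n\<close> and the entries of
    \<open>L * (J * K)\<close>.\<close>
  have JF: "J * fun_mat as bs f = fun_mat as bs (\<lambda>a. f (arc_inv a))" for bs :: "'x list" and f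
    unfolding J_def fun_mat_mult[OF as(1)] as(2)
  proof (intro fun_mat_cong)
    fix a b assume "a \<in> set as"
    then have "arc_inv a \<in> arcs \<Delta>" by (simp add: as(2) inv_arc)
    then show "(\<Sum>x\<in>arcs \<Delta>. (if x = arc_inv a then 1 else 0) * f x b) = f (arc_inv a) b"
      using fin by (subst sum.remove[of _ "arc_inv a"]) (auto intro!: sum.neutral)
  qed
  have "J * J = fun_mat as as (\<lambda>a b. if a = b then 1 else 0)"
    unfolding J_def JF[unfolded J_def] by (intro fun_mat_cong) auto
  then have JJ: "J * J = 1\<^sub>m n"
    by (simp add: fun_mat_one[OF as(1)] n_def)
  have LK: "L * K = A"
  proof -
    have "L * K = fun_mat vs vs (\<lambda>u v. fps_const (adj_entry \<Delta> \<tau>\<^sub>1 \<tau>\<^sub>2 u v))"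
      unfolding L_def K_def fun_mat_mult[OF as(1)] as(2)
    proof (intro fun_mat_cong)
      fix u v
      have "(\<Sum>a\<in>arcs \<Delta>. (if tail \<Delta> a = u then \<tau>\<^sub>2 a else 0) * (if head \<Delta> a = v then \<tau>\<^sub>1 a else 0)) =
          adj_entry \<Delta> \<tau>\<^sub>1 \<tau>\<^sub>2 u v"
        unfolding adj_entry_def arcs_from_to_def
        using fin by (intro sum.mono_neutral_cong_right) auto
      then show "(\<Sum>a\<in>arcs \<Delta>. fps_const (if tail \<Delta> a = u then \<tau>\<^sub>2 a else 0) *
          fps_const (if head \<Delta> a = v then \<tau>\<^sub>1 a else 0)) = fps_const (adj_entry \<Delta> \<tau>\<^sub>1 \<tau>\<^sub>2 u v)"
        by (simp add: sum_fps_const)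
    qed
    then show ?thesis by (simp add: A_def fps_matrix_def fun_mat_def)
  qed
  \<comment> \<open>Inversion turns the head condition of \<open>K\<close> into a tail condition.
    Both factors then test the tail of the same arc, so only diagonal entries survive.\<close>
  have LJK: "L * (J * K) = D"
  proof -
    have "L * (J * K) = fun_mat vs vs (\<lambda>u v. fps_const (deg_entry \<Delta> \<tau>\<^sub>1 \<tau>\<^sub>2 u v))"
      unfolding L_def K_def JF fun_mat_mult[OF as(1)] as(2)
    proof (intro fun_mat_cong)
      fix u v
      have "(\<Sum>a\<in>arcs \<Delta>. (if tail \<Delta> a = u then \<tau>\<^sub>2 a else 0) * (if tail \<Delta> a = v then \<tau>\<^sub>1 (arc_inv a) else 0)) =
          (if u = v then \<Sum>a\<in>out_arcs \<Delta> u. \<tau>\<^sub>1 (arc_inv a) * \<tau>\<^sub>2 a else 0)"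
      proof (cases "u = v")
        case True
        then show ?thesis using fin
          by (simp, intro sum.mono_neutral_cong_right) (auto simp: out_arcs_def)
      qed (auto intro!: sum.neutral)
      then show "(\<Sum>a\<in>arcs \<Delta>. fps_const (if tail \<Delta> a = u then \<tau>\<^sub>2 a else 0) *
          fps_const (if head \<Delta> (arc_inv a) = v then \<tau>\<^sub>1 (arc_inv a) else 0)) =
          fps_const (deg_entry \<Delta> \<tau>\<^sub>1 \<tau>\<^sub>2 u v)"
        by (simp add: sum_fps_const deg_entry_def)
    qed
    then show ?thesis by (simp add: D_def fps_matrix_def fun_mat_def)
  qed
  have KL: "K * L = fun_mat as as (\<lambda>a b. fps_const (if head \<Delta> a = tail \<Delta> b then \<tau>\<^sub>1 a * \<tau>\<^sub>2 b else 0))"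
    unfolding L_def K_def fun_mat_mult[OF assms(3)]
  proof (intro fun_mat_cong)
    fix a b assume "a \<in> set as"
    then have "head \<Delta> a \<in> set vs" using head_vs as(2) by simp
    then show "(\<Sum>v\<in>set vs. fps_const (if head \<Delta> a = v then \<tau>\<^sub>1 a else 0) *
        fps_const (if tail \<Delta> b = v then \<tau>\<^sub>2 b else 0)) =
        fps_const (if head \<Delta> a = tail \<Delta> b then \<tau>\<^sub>1 a * \<tau>\<^sub>2 b else 0)"
      by (subst sum.remove[of _ "head \<Delta> a"]) (auto intro!: sum.neutral split: if_splits)
  qed
  have "inverse (zeta_fps \<Delta> \<theta>) =
      det (1\<^sub>m n - fps_X \<cdot>\<^sub>m fun_mat as as (\<lambda>a b. fps_const (\<theta> a b)))"
    unfolding n_def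
  proof (rule inverse_zeta_fps_eq_det[OF as])
    fix a b assume "head \<Delta> a \<noteq> tail \<Delta> b"
    \<comment> \<open>The inverse of \<open>a\<close> starts at the head of \<open>a\<close>, so the
      subtracted indicator vanishes together with the first term.\<close>
    then show "\<theta> a b = 0" by (auto simp: \<theta>_def theta_weight_def tail_inv)
  qed
  also have "1\<^sub>m n - fps_X \<cdot>\<^sub>m fun_mat as as (\<lambda>a b. fps_const (\<theta> a b)) =
      1\<^sub>m n + fps_X \<cdot>\<^sub>m J - fps_X \<cdot>\<^sub>m (K * L)"
    unfolding KL J_def n_def
    by (intro eq_matI) (auto simp: \<theta>_def theta_weight_def algebra_simps simp flip: fps_const_sub)
  \<comment> \<open>Here t is \<open>fps_X\<close> and c is the inverse of
    \<open>1 - fps_X ^ 2\<close>, which is a unit because its constant term is 1.\<close>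
  also have "det \<dots> = (1 - fps_X ^ 2) ^ length es *
      (inverse (1 - fps_X ^ 2) ^ m * det (1\<^sub>m m - fps_X \<cdot>\<^sub>m A + fps_X ^ 2 \<cdot>\<^sub>m (D - 1\<^sub>m m)))"
    using det_one_plus_involution_minus_mult[OF carr(3) JJ carr(1,2), of "inverse (1 - fps_X ^ 2)" fps_X]
      det_arc_inv[OF es(1), of "fps_X :: complex fps", folded as_def, folded J_def n_def]
    by (simp add: LK LJK inverse_mult_eq_1)
  also have "\<dots> = (1 - fps_X ^ 2) powi (int (length es) - int m) *
      det (1\<^sub>m m - fps_X \<cdot>\<^sub>m A + fps_X ^ 2 \<cdot>\<^sub>m (D - 1\<^sub>m m))"
    by (subst fps_power_int_diff) (simp_all add: mult.assoc)
  finally show ?thesis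
    by (simp add: card I_def)
qed

end
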